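(* Let $N=\{1,\dots,n\}$ be a finite set of agents, $A$ a non-empty finite set of objects, $a_0$ the outside option, and $\succ_A=(\succ_a)_{a\in A}$ a priority structure. If the agent-proposing deferred acceptance (APDA) rule $D^{\succ_A}$ is OSP-implementable on the domain $\mathbb{L}^n(A\cup\{a_0\})$ of all preference profiles, then $\succ_A$ is strongly acyclic (it contains no weak cycle).
   Context: **Setting.** $N=\{1,\dots,n\}$ is a finite set of agents, $A$ a non-empty finite set of objects, and $a_0\notin A$ the outside option. An allocation is a function $\mu:N\to A\cup\{a_0\}$ with $|\mu^{-1}(a)|\le 1$ for all $a\in A$; $\mathcal{M}$ is the set of allocations. For a finite set $X$, $\mathbb{L}(X)$ is the set of strict linear orders on $X$; a preference is an element $P$ of $\mathbb{L}(A\cup\{a_0\})$, with weak part $R$ ($x\,R\,y$ iff $x\,P\,y$ or $x=y$). A domain is a product $\mathcal{P}_N=\prod_{i\in N}\mathcal{P}_i$ with $\mathcal{P}_i\subseteq\mathbb{L}(A\cup\{a_0\})$; an assignment rule is a function $f:\mathcal{P}_N\to\mathcal{M}$, and $f_i(P_N)$ is agent $i$'s assignment. A priority structure is a collection $\succ_A=(\succ_a)_{a\in A}$ with $\succ_a\in\mathbb{L}(N)$; $i\succ N'$ means $i\succ j$ for all $j\in N'$. **Weak cycle.** A tuple $[(i_1,i_2,i_3),(a_1,a_2,a_3)]$ with $i_1,i_2,i_3\in N$ distinct and $a_1,a_2,a_3\in A$ distinct is a weak cycle in $\succ_A$ if $i_1\succ_{a_1}\{i_2,i_3\}$, $i_2\succ_{a_2}\{i_1,i_3\}$,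 and $i_3\succ_{a_3}\{i_1,i_2\}$. $\succ_A$ is strongly acyclic if it contains no weak cycle. **APDA rule.** $D^{\succ_A}$ is computed at $P_N$ as follows. Step 1: each agent applies to her favorite element of $A\cup\{a_0\}$; an agent applying to $a_0$ is assigned $a_0$; for each object $a$ with at least one applicant, the $\succ_a$-best applicant tentatively holds $a$ and the others are rejected. Each later step: every agent rejected at the previous step applies to her next favorite element; an agent applying to $a_0$ is assigned $a_0$; for each object $a$, among the new applicants and the current tentative holder (if any), the $\succ_a$-best tentatively holds $a$ and the others are rejected. This is repeated until no agent is rejected; tentative holdings then become final. **Mechanisms.** For a rooted directed tree $T$, let $V(T),E(T),r(T),L(T)$ denote its nodes, edges, root and leaves; $E^{out}(v)$ the outgoing edges of $v$; $s(e)$ the source of $e$. A mechanism on $\mathcal{P}_N$ is a tuple $G=\langle T,\eta^{LA},\eta^{NA},\eta^{EP}\rangle$ where $T$ is a rooted tree, $\eta^{LA}:L(T)\to\mathcal{M}$, $\eta^{NA}:V(T)\setminus L(T)\to N$, and $\eta^{EP}:E(T)\to 2^{\mathbb{L}(A\cup\{a_0\})}\setminus\{\emptyset\}$ such that (a) $\eta^{EP}(e)\cap\eta^{EP}(e')=\emptyset$ for distinct $e,e'$ with $s(e)=s(e')$; (b) for each $v\in V(T)\setminus L(T)$: if on the path $(v^1,\dots,v^t)$ from $r(T)$ to $v$ there is $t'<t$ with $\eta^{NA}(v^{t'})=\eta^{NA}(v)$ and $\eta^{NA}(v^{s})\ne\eta^{NA}(v)$ for $t'<s<t$, then $\bigcup_{e\in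 E^{out}(v)}\eta^{EP}(e)=\eta^{EP}(v^{t'},v^{t'+1})$; otherwise $\bigcup_{e\in E^{out}(v)}\eta^{EP}(e)=\mathcal{P}_{\eta^{NA}(v)}$. Each $P_N\in\mathcal{P}_N$ determines a unique root-to-leaf path, following at each node $v$ the outgoing edge $e$ with $P_{\eta^{NA}(v)}\in\eta^{EP}(e)$; $P_N$ passes through the nodes of this path, and $f^G(P_N)=\eta^{LA}(l)$ where $l$ is its leaf. Preferences $P_i,P_i'$ diverge at $v$ if $\eta^{NA}(v)=i$ and they belong to $\eta^{EP}(e),\eta^{EP}(e')$ for two distinct $e,e'\in E^{out}(v)$. **OSP.** $G$ is OSP if for all $i\in N$, all $v$ with $\eta^{NA}(v)=i$, and all $P_N,\tilde P_N\in\mathcal{P}_N$ passing through $v$ such that $P_i,\tilde P_i$ diverge at $v$, we have $f^G_i(P_N)\,R_i\,f^G_i(\tilde P_N)$. An assignment rule $f$ on $\mathcal{P}_N$ is OSP-implementable if $f=f^G$ for some OSP mechanism $G$ on $\mathcal{P}_N$. *)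

theory Defs
  imports
    "HOL-Library.FuncSet"
    "HOL-Library.While_Combinator"
    "Graph_Theory.Digraph"
    "Graph_Theory.Arc_Walk"
begin

section \<open>Preferences, allocations and priorities\<close>

text \<open>
  A strict linear order is a relation, with \<open>(x, y) \<in> P\<close> meaning that \<open>x\<close> is preferred to
  (has priority over) \<open>y\<close>. The library predicate \<open>strict_linear_order_on\<close> does not confine
  the relation to its carrier, hence the extra inclusion.
\<close>

definition linear_orders :: "'b set \<Rightarrow> ('b \<times> 'b) set set" where
  "linear_orders X = {P. P \<subseteq> X \<times> X \<and> strict_linear_order_on X P}"

definition weak_part :: "('b \<times> 'b) set \<Rightarrow> 'b \<Rightarrow> 'b \<Rightarrow> bool" where
  "weak_part P x y \<longleftrightarrow> (x, y) \<in> P \<or> x = y"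

definition best :: "('b \<times> 'b) set \<Rightarrow> 'b set \<Rightarrow> 'b" where
  "best P S = (THE x. x \<in> S \<and> (\<forall>y\<in>S. y \<noteq> x \<longrightarrow> (x, y) \<in> P))"

definition allocations :: "'i set \<Rightarrow> 'a set \<Rightarrow> 'a \<Rightarrow> ('i \<Rightarrow> 'a) set" where
  "allocations N A a0 =
     {\<mu> \<in> N \<rightarrow>\<^sub>E insert a0 A. \<forall>a\<in>A. card {i \<in> N. \<mu> i = a} \<le> 1}"

definition priority_structure :: "'i set \<Rightarrow> 'a set \<Rightarrow> ('a \<Rightarrow> ('i \<times> 'i) set) \<Rightarrow> bool" where
  "priority_structure N A prio \<longleftrightarrow> (\<forall>a\<in>A. prio a \<in> linear_orders N)"

definition dominates :: "('i \<times> 'i) set \<Rightarrow> 'i \<Rightarrow> 'i set \<Rightarrow> bool" where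
  "dominates r i S \<longleftrightarrow> (\<forall>j\<in>S. (i, j) \<in> r)"

definition weak_cycle ::
  "'i set \<Rightarrow> 'a set \<Rightarrow> ('a \<Rightarrow> ('i \<times> 'i) set) \<Rightarrow> 'i \<times> 'i \<times> 'i \<Rightarrow> 'a \<times> 'a \<times> 'a \<Rightarrow> bool" where
  "weak_cycle N A prio = (\<lambda>(i1, i2, i3) (a1, a2, a3).
     {i1, i2, i3} \<subseteq> N \<and> distinct [i1, i2, i3] \<and>
     {a1, a2, a3} \<subseteq> A \<and> distinct [a1, a2, a3] \<and>
     dominates (prio a1) i1 {i2, i3} \<and>
     dominates (prio a2) i2 {i1, i3} \<and>
     dominates (prio a3) i3 {i1, i2})"

definition strongly_acyclic :: "'i set \<Rightarrow> 'a set \<Rightarrow> ('a \<Rightarrow> ('i \<times> 'i) set) \<Rightarrow> bool" where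
  "strongly_acyclic N A prio \<longleftrightarrow> \<not> (\<exists>is as. weak_cycle N A prio is as)"

section \<open>Agent-proposing deferred acceptance\<close>

text \<open>
  A state \<open>(h, R)\<close> records the option \<open>h i\<close> currently held by each agent \<open>i\<close> (\<open>None\<close> if she was
  rejected at the previous step, and for everyone before step 1) and the set \<open>R i\<close> of objects
  that have rejected her so far. In a step, \<open>t i\<close> is the option at which \<open>i\<close> competes: the one
  she holds or, if she holds none, her next favorite one.
\<close>

type_synonym ('i, 'a) apda_state = "('i \<Rightarrow> 'a option) \<times> ('i \<Rightarrow> 'a set)"

definition apda_step ::
  "'i set \<Rightarrow> 'a set \<Rightarrow> 'a \<Rightarrow> ('a \<Rightarrow> ('i \<times> 'i) set) \<Rightarrow> ('i \<Rightarrow> ('a \<times> 'a) set)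
     \<Rightarrow> ('i, 'a) apda_state \<Rightarrow> ('i, 'a) apda_state" where
  "apda_step N A a0 prio P = (\<lambda>(h, R).
     let t = (\<lambda>i. case h i of Some x \<Rightarrow> x | None \<Rightarrow> best (P i) (insert a0 A - R i));
         accepted = (\<lambda>i. t i = a0 \<or> i = best (prio (t i)) {j \<in> N. t j = t i})
     in (\<lambda>i. if accepted i then Some (t i) else None,
         \<lambda>i. if accepted i then R i else insert (t i) (R i)))"

definition apda ::
  "'i set \<Rightarrow> 'a set \<Rightarrow> 'a \<Rightarrow> ('a \<Rightarrow> ('i \<times> 'i) set) \<Rightarrow> ('i \<Rightarrow> ('a \<times> 'a) set) \<Rightarrow> 'i \<Rightarrow> 'a" where
  "apda N A a0 prio P =
     (let (h, R) = while (\<lambda>(h, R). \<exists>i\<in>N. h i = None) (apda_step N A a0 prio P)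
                     (\<lambda>_. None, \<lambda>_. {})
      in (\<lambda>i\<in>N. the (h i)))"

section \<open>Mechanisms\<close>

record ('v, 'e, 'i, 'a) mechanism =
  mtree :: "('v, 'e) pre_digraph"
  mroot :: 'v
  eta_LA :: "'v \<Rightarrow> 'i \<Rightarrow> 'a"
  eta_NA :: "'v \<Rightarrow> 'i"
  eta_EP :: "'e \<Rightarrow> ('a \<times> 'a) set set"

definition rooted_tree :: "('v, 'e) pre_digraph \<Rightarrow> 'v \<Rightarrow> bool" where
  "rooted_tree T r \<longleftrightarrow>
     wf_digraph T \<and> r \<in> verts T \<and> (\<forall>v\<in>verts T. \<exists>!p. pre_digraph.awalk T r p v)"

definition leaves :: "('v, 'e) pre_digraph \<Rightarrow> 'v set" where
  "leaves T = {v \<in> verts T. out_arcs T v = {}}"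

definition passes_through ::
  "('v, 'e, 'i, 'a) mechanism \<Rightarrow> ('i \<Rightarrow> ('a \<times> 'a) set) \<Rightarrow> 'v \<Rightarrow> bool" where
  "passes_through G P v \<longleftrightarrow>
     (\<exists>p. pre_digraph.awalk (mtree G) (mroot G) p v \<and>
          (\<forall>e\<in>set p. P (eta_NA G (tail (mtree G) e)) \<in> eta_EP G e))"

text \<open>
  In the following predicate \<open>p\<close> lists the arcs of a path \<open>(v\<^sup>1, \<dots>, v\<^sup>t)\<close>, so \<open>p ! k\<close> is its
  \<open>k\<close>-th arc counted from zero, and the tails of the arcs of \<open>p\<close> are the nodes strictly before
  \<open>v\<^sup>t\<close>. It says that \<open>p ! k\<close> leaves the last of these nodes that is assigned to agent \<open>i\<close>.
\<close>

definition last_move :: "('v, 'e, 'i, 'a) mechanism \<Rightarrow> 'i \<Rightarrow> 'e list \<Rightarrow> nat \<Rightarrow> bool" where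
  "last_move G i p k \<longleftrightarrow>
     k < length p \<and> eta_NA G (tail (mtree G) (p ! k)) = i \<and>
     (\<forall>s. k < s \<and> s < length p \<longrightarrow> eta_NA G (tail (mtree G) (p ! s)) \<noteq> i)"

text \<open>
  The domain is the product of the sets \<open>Dom i\<close>. The last clause holds automatically for
  finite trees; trees are not required to be finite, so it is what makes every preference
  profile determine a path ending in a leaf.
\<close>

definition is_mechanism ::
  "'i set \<Rightarrow> 'a set \<Rightarrow> 'a \<Rightarrow> ('i \<Rightarrow> ('a \<times> 'a) set set) \<Rightarrow> ('v, 'e, 'i, 'a) mechanism \<Rightarrow> bool" where
  "is_mechanism N A a0 Dom G \<longleftrightarrow>
     (let T = mtree G in
       rooted_tree T (mroot G) \<and>
       (\<forall>l\<in>leaves T. eta_LA G l \<in> allocations N A a0) \<and>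
       (\<forall>v\<in>verts T - leaves T. eta_NA G v \<in> N) \<and>
       (\<forall>e\<in>arcs T. eta_EP G e \<subseteq> linear_orders (insert a0 A) \<and> eta_EP G e \<noteq> {}) \<and>
       (\<forall>e\<in>arcs T. \<forall>e'\<in>arcs T. e \<noteq> e' \<and> tail T e = tail T e' \<longrightarrow>
          eta_EP G e \<inter> eta_EP G e' = {}) \<and>
       (\<forall>v\<in>verts T - leaves T. \<forall>p. pre_digraph.awalk T (mroot G) p v \<longrightarrow>
          (\<forall>k. last_move G (eta_NA G v) p k \<longrightarrow>
             (\<Union>e\<in>out_arcs T v. eta_EP G e) = eta_EP G (p ! k)) \<and>
          ((\<nexists>k. last_move G (eta_NA G v) p k) \<longrightarrow>
             (\<Union>e\<in>out_arcs T v. eta_EP G e) = Dom (eta_NA G v))) \<and>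
       (\<forall>P\<in>Pi\<^sub>E N Dom. \<exists>l\<in>leaves T. passes_through G P l))"

definition mechanism_rule ::
  "('v, 'e, 'i, 'a) mechanism \<Rightarrow> ('i \<Rightarrow> ('a \<times> 'a) set) \<Rightarrow> 'i \<Rightarrow> 'a" where
  "mechanism_rule G P = eta_LA G (THE l. l \<in> leaves (mtree G) \<and> passes_through G P l)"

definition diverge ::
  "('v, 'e, 'i, 'a) mechanism \<Rightarrow> 'i \<Rightarrow> 'v \<Rightarrow> ('a \<times> 'a) set \<Rightarrow> ('a \<times> 'a) set \<Rightarrow> bool" where
  "diverge G i v p p' \<longleftrightarrow>
     eta_NA G v = i \<and>
     (\<exists>e\<in>out_arcs (mtree G) v. \<exists>e'\<in>out_arcs (mtree G) v.
        e \<noteq> e' \<and> p \<in> eta_EP G e \<and> p' \<in> eta_EP G e')"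

definition OSP ::
  "'i set \<Rightarrow> ('i \<Rightarrow> ('a \<times> 'a) set set) \<Rightarrow> ('v, 'e, 'i, 'a) mechanism \<Rightarrow> bool" where
  "OSP N Dom G \<longleftrightarrow>
     (\<forall>i\<in>N. \<forall>v\<in>verts (mtree G) - leaves (mtree G). eta_NA G v = i \<longrightarrow>
       (\<forall>P\<in>Pi\<^sub>E N Dom. \<forall>P'\<in>Pi\<^sub>E N Dom.
          passes_through G P v \<and> passes_through G P' v \<and> diverge G i v (P i) (P' i) \<longrightarrow>
          weak_part (P i) (mechanism_rule G P i) (mechanism_rule G P' i)))"

text \<open>
  HOL cannot quantify existentially over types, so the node and arc types of the mechanism are
  explicit parameters; a theorem with this predicate as a premise and these types left as
  variables covers mechanisms over arbitrary trees.
\<close>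

definition OSP_implementable ::
  "'v itself \<Rightarrow> 'e itself \<Rightarrow> 'i set \<Rightarrow> 'a set \<Rightarrow> 'a \<Rightarrow> ('i \<Rightarrow> ('a \<times> 'a) set set)
     \<Rightarrow> (('i \<Rightarrow> ('a \<times> 'a) set) \<Rightarrow> 'i \<Rightarrow> 'a) \<Rightarrow> bool" where
  "OSP_implementable _ _ N A a0 Dom f \<longleftrightarrow>
     (\<exists>G :: ('v, 'e, 'i, 'a) mechanism.
        is_mechanism N A a0 Dom G \<and> OSP N Dom G \<and> (\<forall>P\<in>Pi\<^sub>E N Dom. f P = mechanism_rule G P))"

end

theory Submission
  imports Defs
begin

text \<open>
  Only the stability of deferred acceptance matters. Given a weak cycle, two of its three objects
  rank the remaining two agents in the same rotational sense, so up to relabelling \<open>a1\<close> ranks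
  \<open>i1\<close>, \<open>i2\<close>, \<open>i3\<close> in this order, \<open>a2\<close> ranks \<open>i2\<close>, \<open>i3\<close>, \<open>i1\<close> in this order, and \<open>a3\<close> ranks \<open>i3\<close>
  first. Let \<open>i1\<close> have the acceptable objects \<open>a3, a1\<close> or \<open>a2, a3\<close>, let \<open>i2\<close> have \<open>a1, a3\<close> or just
  \<open>a3\<close>, let \<open>i3\<close> have \<open>a1, a3\<close> or \<open>a1, a2\<close>, and let nobody else want any object. An OSP mechanism
  must at some node be the first to separate the two preferences of some agent; but in a stable
  rule each of the three agents has a truthful report that may end worse for her than the other
  report does against some other profile.
\<close>

section \<open>Linear orders\<close>

lemma linear_ordersD:
  assumes "P \<in> linear_orders X"
  shows linear_orders_carrier: "(x, y) \<in> P \<Longrightarrow> x \<in> X \<and> y \<in> X"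
    and linear_orders_trans: "(x, y) \<in> P \<Longrightarrow> (y, z) \<in> P \<Longrightarrow> (x, z) \<in> P"
    and linear_orders_irrefl: "(x, x) \<notin> P"
    and linear_orders_asym: "(x, y) \<in> P \<Longrightarrow> (y, x) \<notin> P"
    and linear_orders_total: "x \<in> X \<Longrightarrow> y \<in> X \<Longrightarrow> x \<noteq> y \<Longrightarrow> (x, y) \<in> P \<or> (y, x) \<in> P"
proof -
  have P: "P \<subseteq> X \<times> X" "trans P" "irrefl P" "total_on X P"
    using assms by (auto simp: linear_orders_def strict_linear_order_on_def)
  show "(x, y) \<in> P \<Longrightarrow> x \<in> X \<and> y \<in> X"
    using P(1) by blast
  show "(x, y) \<in> P \<Longrightarrow> (y, z) \<in> P \<Longrightarrow> (x, z) \<in> P"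
    by (rule transD[OF P(2)])
  show "(x, x) \<notin> P"
    using P(3) by (simp add: irrefl_def)
  show "(x, y) \<in> P \<Longrightarrow> (y, x) \<notin> P"
    using P(2,3) by (meson irrefl_def transD)
  show "x \<in> X \<Longrightarrow> y \<in> X \<Longrightarrow> x \<noteq> y \<Longrightarrow> (x, y) \<in> P \<or> (y, x) \<in> P"
    using P(4) by (simp add: total_on_def)
qed

text \<open>Makes the definite description in \<open>best\<close> usable. A greatest element exists
  by induction on the finite set, and asymmetry makes it unique.\<close>

lemma best_greatest:
  assumes "P \<in> linear_orders X" and "finite S" and "S \<noteq> {}" and "S \<subseteq> X"
  shows best_in: "best P S \<in> S"
    and best_above: "y \<in> S \<Longrightarrow> y \<noteq> best P S \<Longrightarrow> (best P S, y) \<in> P"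
proof -
  have "\<exists>x\<in>S. \<forall>y\<in>S. y \<noteq> x \<longrightarrow> (x, y) \<in> P"
    using assms(2-4)
  proof (induction S rule: finite_ne_induct)
    case (insert z F)
    then obtain x where x: "x \<in> F" "\<And>y. y \<in> F \<Longrightarrow> y \<noteq> x \<Longrightarrow> (x, y) \<in> P"
      by auto
    with insert have "(x, z) \<in> P \<or> (z, x) \<in> P"
      using linear_orders_total[OF assms(1), of x z] by auto
    then show ?case
      using x linear_orders_trans[OF assms(1)] by (metis insert_iff)
  qed auto
  then have "\<exists>!x. x \<in> S \<and> (\<forall>y\<in>S. y \<noteq> x \<longrightarrow> (x, y) \<in> P)"
    using linear_orders_asym[OF assms(1)] by metis
  note best = theI'[OF this, folded best_def]
  show "best P S \<in> S"
    using best by blast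
  show "(best P S, y) \<in> P" if "y \<in> S" "y \<noteq> best P S"
    using best that by blast
qed

text \<open>Prescribing the full strict upper set of every listed element fixes the order of the
  list and leaves everything unlisted below it. With \<open>a0\<close> as last entry, the entries
  before it are exactly the acceptable objects.\<close>

definition starts_with :: "('b \<times> 'b) set \<Rightarrow> 'b list \<Rightarrow> bool" where
  "starts_with P xs \<longleftrightarrow> (\<forall>k<length xs. {w. (w, xs ! k) \<in> P} = set (take k xs))"

lemma starts_withD:
  "starts_with P xs \<Longrightarrow> k < length xs \<Longrightarrow> (w, xs ! k) \<in> P \<longleftrightarrow> w \<in> set (take k xs)"
  unfolding starts_with_def by blast

text \<open>Complete \<open>xs\<close> to an enumeration of \<open>X\<close> and compare elements by
  position.\<close>

lemma linear_order_starting_with: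
  assumes "finite X" and "distinct xs" and "set xs \<subseteq> X"
  shows "\<exists>P\<in>linear_orders X. starts_with P xs"
proof -
  obtain zs where zs: "set zs = X - set xs" "distinct zs"
    using finite_distinct_list[of "X - set xs"] assms(1) by auto
  define ys where "ys = xs @ zs"
  have ys: "distinct ys" "set ys = X"
    using zs assms by (auto simp: ys_def)
  have "\<forall>x\<in>X. \<exists>i<length ys. ys ! i = x"
    using ys(2) by (auto simp: in_set_conv_nth)
  then obtain pos where pos: "\<And>x. x \<in> X \<Longrightarrow> pos x < length ys \<and> ys ! pos x = x"
    by metis
  have pos_nth: "pos (ys ! i) = i" if "i < length ys" for i
    using pos[of "ys ! i"] that ys nth_eq_iff_index_eq by fastforce
  define P where "P = {(x, y). x \<in> X \<and> y \<in> X \<and> pos x < pos y}"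
  have pos_inj: "x = y" if "x \<in> X" "y \<in> X" "pos x = pos y" for x y
    using pos[OF that(1)] pos[OF that(2)] that(3) by metis
  have "trans P" "irrefl P"
    by (auto simp: P_def trans_def irrefl_def)
  moreover have "total_on X P"
    using pos_inj by (auto simp: P_def total_on_def) (meson linorder_neqE_nat)
  ultimately have "P \<in> linear_orders X"
    by (auto simp: linear_orders_def strict_linear_order_on_def P_def)
  moreover have "starts_with P xs"
    unfolding starts_with_def
  proof (intro allI impI)
    fix k assume k: "k < length xs"
    then have xk: "xs ! k \<in> X" "pos (xs ! k) = k"
      using pos_nth[of k] assms(3) by (auto simp: ys_def nth_append)
    have "w \<in> set (take k xs) \<longleftrightarrow> w \<in> X \<and> pos w < k" for w
    proof
      assume "w \<in> set (take k xs)"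
      then obtain j where "j < k" "w = ys ! j" "j < length ys"
        using k by (auto simp: in_set_conv_nth ys_def nth_append)
      then show "w \<in> X \<and> pos w < k"
        using pos_nth[of j] ys(2) by auto
    next
      assume w: "w \<in> X \<and> pos w < k"
      then have "take k xs ! pos w = w"
        using pos[of w] k by (simp add: ys_def nth_append)
      then show "w \<in> set (take k xs)"
        using w k by (metis length_take min.absorb4 nth_mem)
    qed
    then show "{w. (w, xs ! k) \<in> P} = set (take k xs)"
      using xk by (auto simp: P_def)
  qed
  ultimately show ?thesis by blast
qed

section \<open>Weak cycles\<close>

lemma weak_cycle_iff:
  "weak_cycle N A prio (i1, i2, i3) (a1, a2, a3) \<longleftrightarrow>
     i1 \<in> N \<and> i2 \<in> N \<and> i3 \<in> N \<and> i1 \<noteq> i2 \<and> i1 \<noteq> i3 \<and> i2 \<noteq> i3 \<and>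
     a1 \<in> A \<and> a2 \<in> A \<and> a3 \<in> A \<and> a1 \<noteq> a2 \<and> a1 \<noteq> a3 \<and> a2 \<noteq> a3 \<and>
     (i1, i2) \<in> prio a1 \<and> (i1, i3) \<in> prio a1 \<and> (i2, i1) \<in> prio a2 \<and> (i2, i3) \<in> prio a2 \<and>
     (i3, i1) \<in> prio a3 \<and> (i3, i2) \<in> prio a3"
  by (simp add: weak_cycle_def dominates_def conj_ac)

lemma weak_cycle_rotate:
  "weak_cycle N A prio (i1, i2, i3) (a1, a2, a3) \<Longrightarrow> weak_cycle N A prio (i2, i3, i1) (a2, a3, a1)"
  unfolding weak_cycle_iff by blast

lemma weak_cycle_swap:
  "weak_cycle N A prio (i1, i2, i3) (a1, a2, a3) \<Longrightarrow> weak_cycle N A prio (i2, i1, i3) (a2, a1, a3)"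
  unfolding weak_cycle_iff by blast

text \<open>Each object of the cycle ranks its two lower agents in one of two rotational senses, so
  two of the three objects agree. Rotations move these two to the first places; the swap reverses
  the sense. The six relabellings are handed to the last step.\<close>

lemma weak_cycle_normalize:
  assumes prio: "priority_structure N A prio"
    and "weak_cycle N A prio (i1, i2, i3) (a1, a2, a3)"
  shows "\<exists>i1 i2 i3 a1 a2 a3. weak_cycle N A prio (i1, i2, i3) (a1, a2, a3) \<and>
    (i2, i3) \<in> prio a1 \<and> (i3, i1) \<in> prio a2"
proof -
  have elems: "i1 \<in> N" "i2 \<in> N" "i3 \<in> N" "i1 \<noteq> i2" "i1 \<noteq> i3" "i2 \<noteq> i3"
    and lo: "prio a1 \<in> linear_orders N" "prio a2 \<in> linear_orders N" "prio a3 \<in> linear_orders N"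
    using assms unfolding weak_cycle_iff priority_structure_def by blast+
  have "(i2, i3) \<in> prio a1 \<or> (i3, i2) \<in> prio a1"
    by (rule linear_orders_total[OF lo(1) elems(2,3,6)])
  moreover have "(i1, i3) \<in> prio a2 \<or> (i3, i1) \<in> prio a2"
    by (rule linear_orders_total[OF lo(2) elems(1,3,5)])
  moreover have "(i1, i2) \<in> prio a3 \<or> (i2, i1) \<in> prio a3"
    by (rule linear_orders_total[OF lo(3) elems(1,2,4)])
  moreover note assms(2) assms(2)[THEN weak_cycle_rotate]
    assms(2)[THEN weak_cycle_rotate, THEN weak_cycle_rotate]
    assms(2)[THEN weak_cycle_swap] assms(2)[THEN weak_cycle_swap, THEN weak_cycle_rotate]
    assms(2)[THEN weak_cycle_swap, THEN weak_cycle_rotate, THEN weak_cycle_rotate]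
  ultimately show ?thesis
    by blast
qed

section \<open>Stability of deferred acceptance\<close>

text \<open>
  The last clause combines individual rationality (nothing outside \<open>A\<close>, in particular not \<open>a0\<close>, is
  preferred to the assignment) with the absence of blocking pairs.
\<close>

definition stable_matching ::
  "'i set \<Rightarrow> 'a set \<Rightarrow> 'a \<Rightarrow> ('a \<Rightarrow> ('i \<times> 'i) set) \<Rightarrow> ('i \<Rightarrow> ('a \<times> 'a) set) \<Rightarrow> ('i \<Rightarrow> 'a) \<Rightarrow> bool" where
  "stable_matching N A a0 prio P \<mu> \<longleftrightarrow>
     (\<forall>i\<in>N. \<mu> i \<in> insert a0 A) \<and>
     (\<forall>i\<in>N. \<forall>j\<in>N. \<mu> i = \<mu> j \<and> \<mu> i \<in> A \<longrightarrow> i = j) \<and>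
     (\<forall>i\<in>N. \<forall>x. (x, \<mu> i) \<in> P i \<longrightarrow> x \<in> A \<and> (\<exists>j\<in>N. \<mu> j = x \<and> (j, i) \<in> prio x))"

text \<open>The second clause says that a held option is the favorite among those that have not yet
  rejected the agent. The third says that a rejecting object is currently held by an agent of higher
  priority; once everybody holds something, this excludes blocking pairs.\<close>

definition apda_inv ::
  "'i set \<Rightarrow> 'a set \<Rightarrow> 'a \<Rightarrow> ('a \<Rightarrow> ('i \<times> 'i) set) \<Rightarrow> ('i \<Rightarrow> ('a \<times> 'a) set)
     \<Rightarrow> ('i, 'a) apda_state \<Rightarrow> bool" where
  "apda_inv N A a0 prio P = (\<lambda>(h, R). \<forall>i\<in>N.
     R i \<subseteq> A \<and>
     (\<forall>x. h i = Some x \<longrightarrow> x = best (P i) (insert a0 A - R i)) \<and>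
     (\<forall>x\<in>R i. \<exists>j\<in>N. h j = Some x \<and> (j, i) \<in> prio x) \<and>
     (\<forall>j\<in>N. \<forall>x\<in>A. h i = Some x \<and> h j = Some x \<longrightarrow> i = j))"

text \<open>A tentative holder competes again at the object she holds, so an object can only pass to
  agents of higher priority. Past rejections therefore stay justified, by transitivity. The strict
  growth of rejection sets serves termination.\<close>

lemma apda_step_inv:
  assumes fin: "finite N" "finite A" and a0: "a0 \<notin> A"
    and prio: "priority_structure N A prio"
    and P: "\<forall>i\<in>N. P i \<in> linear_orders (insert a0 A)"
    and inv: "apda_inv N A a0 prio P (h, R)"
    and step: "apda_step N A a0 prio P (h, R) = (h', R')"
  shows "apda_inv N A a0 prio P (h', R')"
    and "\<And>i. R i \<subseteq> R' i"
    and "\<And>i. i \<in> N \<Longrightarrow> h' i = None \<Longrightarrow> R i \<subset> R' i"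
proof -
  define t where "t = (\<lambda>i. best (P i) (insert a0 A - R i))"
  define u where "u = (\<lambda>i. case h i of Some x \<Rightarrow> x | None \<Rightarrow> t i)"
  define acc where "acc = (\<lambda>i. u i = a0 \<or> i = best (prio (u i)) {j \<in> N. u j = u i})"
  have h': "h' = (\<lambda>i. if acc i then Some (u i) else None)"
    and R': "R' = (\<lambda>i. if acc i then R i else insert (u i) (R i))"
    using step unfolding apda_step_def t_def u_def acc_def Let_def by auto
  have RA: "R i \<subseteq> A" and hold: "h i = Some x \<Longrightarrow> x = t i"
    and rej: "x \<in> R i \<Longrightarrow> \<exists>j\<in>N. h j = Some x \<and> (j, i) \<in> prio x" if "i \<in> N" for i x
    using inv that unfolding apda_inv_def t_def by auto
  \<comment> \<open>By the invariant, holders and new applicants alike compete at their best option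
    that has not rejected them.\<close>
  have ut: "u i = t i" if "i \<in> N" for i
    using hold[OF that] by (auto simp: u_def split: option.split)
  have t_in: "t i \<in> insert a0 A - R i" if "i \<in> N" for i
    unfolding t_def using best_in[OF bspec[OF P that], of "insert a0 A - R i"] fin(2) a0 RA[OF that]
    by auto
  have winner: "\<exists>j\<in>N. acc j \<and> u j = x \<and> (\<forall>i\<in>N. u i = x \<and> i \<noteq> j \<longrightarrow> (j, i) \<in> prio x) \<and>
      (\<forall>i\<in>N. acc i \<and> u i = x \<longrightarrow> i = j)"
    if "x \<in> A" "k \<in> N" "u k = x" for x k
  proof -
    let ?S = "{j \<in> N. u j = x}"
    have lo: "prio x \<in> linear_orders N"
      using prio that(1) by (auto simp: priority_structure_def)
    have S: "finite ?S" "?S \<noteq> {}" "?S \<subseteq> N"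
      using fin that by auto
    have "best (prio x) ?S \<in> ?S"
      by (rule best_in[OF lo S])
    moreover have "(best (prio x) ?S, i) \<in> prio x" if "i \<in> ?S" "i \<noteq> best (prio x) ?S" for i
      by (rule best_above[OF lo S that])
    moreover have "acc i \<longleftrightarrow> i = best (prio x) ?S" if "i \<in> ?S" for i
      using that \<open>x \<in> A\<close> a0 by (auto simp: acc_def)
    ultimately show ?thesis
      by (intro bexI[of _ "best (prio x) ?S"]) auto
  qed
  have uA: "u i \<in> A" if "i \<in> N" "\<not> acc i" for i
    using t_in[OF that(1)] ut[OF that(1)] that(2) by (auto simp: acc_def)
  show "R i \<subseteq> R' i" for i
    by (auto simp: R')
  show "R i \<subset> R' i" if "i \<in> N" "h' i = None" for i
    using that t_in[OF that(1)] ut[OF that(1)] by (auto simp: h' R' split: if_splits)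
  show "apda_inv N A a0 prio P (h', R')"
    unfolding apda_inv_def prod.case
  proof (intro ballI conjI allI impI)
    fix i assume i: "i \<in> N"
    show "R' i \<subseteq> A"
      using RA[OF i] uA[OF i] by (auto simp: R')
    show "x = best (P i) (insert a0 A - R' i)" if "h' i = Some x" for x
      using that ut[OF i] by (auto simp: h' R' t_def split: if_splits)
    show "i = j" if "j \<in> N" "x \<in> A" "h' i = Some x \<and> h' j = Some x" for j x
      using winner[OF that(2) i] that i by (auto simp: h' split: if_splits)
    show "\<exists>j\<in>N. h' j = Some x \<and> (j, i) \<in> prio x" if "x \<in> R' i" for x
    proof (cases "x \<in> R i")
      \<comment> \<open>The old holder \<open>k\<close> of \<open>x\<close> competes at
        \<open>x\<close> again; the new winner is \<open>k\<close> or beats \<open>k\<close>, who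
        beats \<open>i\<close>.\<close>
      case True
      then obtain k where k: "k \<in> N" "h k = Some x" "(k, i) \<in> prio x"
        using rej[OF i] by blast
      have x: "x \<in> A"
        using True RA[OF i] by auto
      have "u k = x"
        using k by (auto simp: u_def)
      from winner[OF x k(1) this] obtain j where "j \<in> N" "acc j" "u j = x"
        "k \<noteq> j \<longrightarrow> (j, k) \<in> prio x"
        using k(1) \<open>u k = x\<close> by blast
      moreover have "prio x \<in> linear_orders N"
        using prio x by (auto simp: priority_structure_def)
      ultimately show ?thesis
        using k(3) linear_orders_trans[of "prio x" N j k i] by (intro bexI[of _ j]) (auto simp: h')
    next
      \<comment> \<open>A fresh rejection: the winner at \<open>u i\<close> is the required
        holder.\<close>
      case False
      with that have x: "x = u i" and na: "\<not> acc i"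
        by (auto simp: R' split: if_splits)
      from winner[OF uA[OF i na] i refl] obtain j where "j \<in> N" "acc j" "u j = x"
        "i \<noteq> j \<longrightarrow> (j, i) \<in> prio x"
        using i x by blast
      with na show ?thesis
        by (intro bexI[of _ j]) (auto simp: h')
    qed
  qed
qed

text \<open>When the loop ends, each agent holds her best option that has not rejected her. Whatever
  she prefers has thus rejected her, and the invariant supplies a holder of higher priority.\<close>

lemma apda_stable:
  assumes fin: "finite N" "finite A" and a0: "a0 \<notin> A"
    and prio: "priority_structure N A prio"
    and P: "\<forall>i\<in>N. P i \<in> linear_orders (insert a0 A)"
  shows "stable_matching N A a0 prio P (apda N A a0 prio P)"
proof -
  let ?I = "apda_inv N A a0 prio P"
  let ?b = "\<lambda>(h, R). \<exists>i\<in>N. h i = None"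
  let ?c = "apda_step N A a0 prio P"
  \<comment> \<open>In the first step possibly nobody is rejected, so the loop guard must be part of the variant.\<close>
  define m :: "('a, 'b) apda_state \<Rightarrow> nat" where
    "m = (\<lambda>(h, R). if \<exists>i\<in>N. h i = None then Suc (\<Sum>i\<in>N. card (A - R i)) else 0)"
  have "case while ?b ?c (\<lambda>_. None, \<lambda>_. {}) of (h, R) \<Rightarrow> ?I (h, R) \<and> (\<forall>i\<in>N. h i \<noteq> None)"
  proof (rule while_rule[where P = ?I and r = "measure m"])
    show "?I (\<lambda>_. None, \<lambda>_. {})"
      by (auto simp: apda_inv_def)
  next
    fix s assume "?I s" "?b s"
    obtain h R h' R' where s: "s = (h, R)" and s': "?c (h, R) = (h', R')"
      by (metis surj_pair)
    show "?I (?c s)"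
      using apda_step_inv(1)[OF fin a0 prio P \<open>?I s\<close>[unfolded s] s'] by (simp add: s s')
  next
    fix s assume "?I s" "?b s"
    obtain h R h' R' where s: "s = (h, R)" and s': "?c (h, R) = (h', R')"
      by (metis surj_pair)
    note step = apda_step_inv[OF fin a0 prio P \<open>?I s\<close>[unfolded s] s']
    have b: "\<exists>i\<in>N. h i = None"
      using \<open>?b s\<close> s by auto
    show "(?c s, s) \<in> measure m"
    proof (cases "\<exists>i\<in>N. h' i = None")
      case True
      then obtain i where i: "i \<in> N" "h' i = None" by auto
      have "R' i \<subseteq> A"
        using step(1) i(1) by (auto simp: apda_inv_def)
      with step(3)[OF i] have "A - R' i \<subset> A - R i"
        by auto
      then have "card (A - R' i) < card (A - R i)"
        using fin(2) by (intro psubset_card_mono) auto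
      moreover have "card (A - R' j) \<le> card (A - R j)" for j
        using step(2)[of j] fin(2) by (intro card_mono) auto
      ultimately have "(\<Sum>i\<in>N. card (A - R' i)) < (\<Sum>i\<in>N. card (A - R i))"
        using fin(1) i(1) by (intro sum_strict_mono_ex1) auto
      then show ?thesis
        using True b by (auto simp: m_def s s')
    next
      case False
      then show ?thesis
        using b by (auto simp: m_def s s')
    qed
  qed auto
  then obtain h R where while: "while ?b ?c (\<lambda>_. None, \<lambda>_. {}) = (h, R)"
    and inv: "?I (h, R)" and all: "\<And>i. i \<in> N \<Longrightarrow> h i \<noteq> None"
    by (auto split: prod.splits)
  define \<mu> where "\<mu> = apda N A a0 prio P"
  have h: "h i = Some (\<mu> i)" if "i \<in> N" for i
    using all[OF that] that by (simp add: \<mu>_def apda_def while)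
  have RA: "R i \<subseteq> A" if "i \<in> N" for i
    using inv that by (auto simp: apda_inv_def)
  have \<mu>: "\<mu> i = best (P i) (insert a0 A - R i)" if "i \<in> N" for i
    using inv that h by (auto simp: apda_inv_def)
  have S: "finite (insert a0 A - R i)" "insert a0 A - R i \<noteq> {}" "insert a0 A - R i \<subseteq> insert a0 A"
    if "i \<in> N" for i
    using fin(2) a0 RA[OF that] by auto
  show ?thesis
    unfolding stable_matching_def \<mu>_def[symmetric]
  proof (intro conjI ballI allI impI)
    fix i assume i: "i \<in> N"
    show "\<mu> i \<in> insert a0 A"
      using best_in[OF bspec[OF P i] S[OF i]] \<mu>[OF i] by auto
    show "i = j" if "j \<in> N" "\<mu> i = \<mu> j \<and> \<mu> i \<in> A" for j
      using inv i that h[OF i] h[OF that(1)] by (auto simp: apda_inv_def)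
    fix x assume x: "(x, \<mu> i) \<in> P i"
    have "x \<in> R i"
    proof (rule ccontr)
      assume "x \<notin> R i"
      then have "x \<in> insert a0 A - R i"
        using linear_orders_carrier[OF bspec[OF P i] x] by auto
      from best_above[OF bspec[OF P i] S[OF i] this] show False
        using x \<mu>[OF i] linear_orders_asym[OF bspec[OF P i] x] linear_orders_irrefl[OF bspec[OF P i]] by auto
    qed
    with RA[OF i] show "x \<in> A"
      by blast
    from \<open>x \<in> R i\<close> obtain j where "j \<in> N" "h j = Some x" "(j, i) \<in> prio x"
      using inv i unfolding apda_inv_def prod.case by blast
    then show "\<exists>j\<in>N. \<mu> j = x \<and> (j, i) \<in> prio x"
      using h[of j] by auto
  qed
qed

text \<open>Individual rationality keeps the assignment on the list or at \<open>a0\<close>. If it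
  is not among the first \<open>k + 1\<close> entries, then \<open>xs ! k\<close> is preferred to
  it, and the absence of blocking pairs yields the holder \<open>j\<close>.\<close>

lemma stable_starts_with:
  assumes "stable_matching N A a0 prio P \<mu>" and "i \<in> N" and P: "P i \<in> linear_orders (insert a0 A)"
    and xs: "starts_with (P i) (xs @ [a0])" "set xs \<subseteq> A" and a0: "a0 \<notin> A"
  shows "\<mu> i \<in> insert a0 (set xs)"
    and "\<And>k. k < length xs \<Longrightarrow> \<mu> i \<notin> set (take (Suc k) xs) \<Longrightarrow>
      \<exists>j\<in>N. \<mu> j = xs ! k \<and> (j, i) \<in> prio (xs ! k)"
proof -
  have \<mu>: "\<mu> i \<in> insert a0 A"
    and blocking: "(x, \<mu> i) \<in> P i \<Longrightarrow> x \<in> A \<and> (\<exists>j\<in>N. \<mu> j = x \<and> (j, i) \<in> prio x)" for x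
    using assms(1,2) by (auto simp: stable_matching_def)
  have above: "(w, xs ! k) \<in> P i \<longleftrightarrow> w \<in> set (take k xs)" if "k < length xs" for k w
    using starts_withD[OF xs(1), of k w] that by (simp add: nth_append)
  have above_a0: "(w, a0) \<in> P i \<longleftrightarrow> w \<in> set xs" for w
    using starts_withD[OF xs(1), of "length xs" w] by simp
  show "\<mu> i \<in> insert a0 (set xs)"
    using linear_orders_total[OF P, of a0 "\<mu> i"] \<mu> blocking[of a0] above_a0 a0 by auto
  fix k assume k: "k < length xs" "\<mu> i \<notin> set (take (Suc k) xs)"
  have "xs ! k \<noteq> \<mu> i" "\<mu> i \<notin> set (take k xs)"
    using k by (auto simp: take_Suc_conv_app_nth)
  then have "(xs ! k, \<mu> i) \<in> P i"
    using linear_orders_total[OF P, of "xs ! k" "\<mu> i"] \<mu> xs(2) k(1) above[OF k(1)] nth_mem[OF k(1)]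
    by blast
  then show "\<exists>j\<in>N. \<mu> j = xs ! k \<and> (j, i) \<in> prio (xs ! k)"
    using blocking by blast
qed

section \<open>First divergence in an OSP mechanism\<close>

text \<open>Disjoint labels leave at most one arc to follow at each node, and no arc leaves a leaf,
  so two walks to leaves that follow \<open>P\<close> coincide. This justifies the
  \<open>THE\<close> in \<open>mechanism_rule\<close>.\<close>

lemma passing_leaf_unique:
  assumes T: "wf_digraph (mtree G)"
    and disj: "\<And>e e'. e \<in> arcs (mtree G) \<Longrightarrow> e' \<in> arcs (mtree G) \<Longrightarrow> e \<noteq> e' \<Longrightarrow>
      tail (mtree G) e = tail (mtree G) e' \<Longrightarrow> eta_EP G e \<inter> eta_EP G e' = {}"
    and l: "l \<in> leaves (mtree G)" "passes_through G P l"
    and l': "l' \<in> leaves (mtree G)" "passes_through G P l'"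
  shows "l = l'"
proof -
  let ?T = "mtree G"
  let ?ok = "\<lambda>p. \<forall>e\<in>set p. P (eta_NA G (tail ?T e)) \<in> eta_EP G e"
  let ?walk = "pre_digraph.awalk ?T"
  note walk_Nil = wf_digraph.awalk_Nil_iff[OF T]
    and walk_Cons = wf_digraph.awalk_Cons_iff[OF T]
  have "l = l'" if "?walk u p l" "?ok p" "?walk u p' l'" "?ok p'" for u p p'
    using that
  proof (induction p arbitrary: u p')
    case Nil
    then have "u = l" by (simp add: walk_Nil)
    with Nil l(1) show ?case
      by (cases p') (auto simp: walk_Cons walk_Nil leaves_def out_arcs_def)
  next
    case (Cons e p)
    then obtain e' p'' where p': "p' = e' # p''"
      using l'(1) by (cases p') (auto simp: walk_Cons walk_Nil leaves_def out_arcs_def)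
    have "e = e'"
      using Cons.prems disj[of e e'] by (auto simp: p' walk_Cons)
    then show ?case
      using Cons.IH[of "head ?T e" p''] Cons.prems by (auto simp: p' walk_Cons)
  qed
  then show ?thesis
    using l(2) l'(2) unfolding passes_through_def by blast
qed

text \<open>Restrict the profiles to a product subdomain \<open>Q\<close> and walk along the path of
  \<open>P\<close> up to the first arc that some profile in \<open>Q\<close> leaves. All of
  \<open>Q\<close> reaches its source, so OSP there compares any two profiles that differ in the
  separated reports, whatever the other agents report.\<close>

lemma OSP_first_divergence:
  assumes mech: "is_mechanism N A a0 Dom G" and osp: "OSP N Dom G"
    and Q: "\<And>i. i \<in> N \<Longrightarrow> Q i \<subseteq> Dom i"
    and P: "P \<in> Pi\<^sub>E N Q" and P': "P' \<in> Pi\<^sub>E N Q"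
    and ne: "mechanism_rule G P \<noteq> mechanism_rule G P'"
  shows "\<exists>i\<in>N. \<exists>p\<in>Q i. \<exists>p'\<in>Q i. p \<noteq> p' \<and>
    (\<forall>R\<in>Pi\<^sub>E N Q. \<forall>R'\<in>Pi\<^sub>E N Q. R i = p \<and> R' i = p' \<longrightarrow>
       weak_part p (mechanism_rule G R i) (mechanism_rule G R' i) \<and>
       weak_part p' (mechanism_rule G R' i) (mechanism_rule G R i))"
proof -
  let ?T = "mtree G"
  let ?follows = "\<lambda>R e. R (eta_NA G (tail ?T e)) \<in> eta_EP G e"
  have tree: "rooted_tree ?T (mroot G)"
    and mover: "\<forall>v\<in>verts ?T - leaves ?T. eta_NA G v \<in> N"
    and disjoint: "\<forall>e\<in>arcs ?T. \<forall>e'\<in>arcs ?T. e \<noteq> e' \<and> tail ?T e = tail ?T e' \<longrightarrow>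
      eta_EP G e \<inter> eta_EP G e' = {}"
    and cover: "\<forall>v\<in>verts ?T - leaves ?T. \<forall>p. pre_digraph.awalk ?T (mroot G) p v \<longrightarrow>
      (\<forall>k. last_move G (eta_NA G v) p k \<longrightarrow> (\<Union>e\<in>out_arcs ?T v. eta_EP G e) = eta_EP G (p ! k)) \<and>
      ((\<nexists>k. last_move G (eta_NA G v) p k) \<longrightarrow>
        (\<Union>e\<in>out_arcs ?T v. eta_EP G e) = Dom (eta_NA G v))"
    and leaf: "\<forall>P\<in>Pi\<^sub>E N Dom. \<exists>l\<in>leaves ?T. passes_through G P l"
    using mech[unfolded is_mechanism_def Let_def] by - (elim conjE, assumption)+
  have T: "wf_digraph ?T"
    using tree by (simp add: rooted_tree_def)
  let ?walk = "pre_digraph.awalk ?T"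
  have QD: "R \<in> Pi\<^sub>E N Dom" if "R \<in> Pi\<^sub>E N Q" for R
    using that Q by (auto simp: PiE_iff)
  have disj: "eta_EP G e \<inter> eta_EP G e' = {}"
    if "e \<in> arcs ?T" "e' \<in> arcs ?T" "e \<noteq> e'" "tail ?T e = tail ?T e'" for e e'
    using disjoint that by simp
  obtain l where l: "l \<in> leaves ?T" "passes_through G P l"
    using bspec[OF leaf QD[OF P]] by blast
  then obtain p where p: "?walk (mroot G) p l" "\<forall>e\<in>set p. ?follows P e"
    by (auto simp: passes_through_def)
  \<comment> \<open>Otherwise all of \<open>Q\<close> would end at the leaf \<open>l\<close> and the
    rule would be constant on \<open>Q\<close>, against \<open>ne\<close>.\<close>
  have "\<exists>k<length p. \<exists>R\<in>Pi\<^sub>E N Q. \<not> ?follows R (p ! k)"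
  proof (rule ccontr)
    assume "\<not> ?thesis"
    then have "passes_through G R l" if "R \<in> Pi\<^sub>E N Q" for R
      using that p(1) unfolding passes_through_def by (metis in_set_conv_nth)
    moreover have "l'' = l'"
      if "l' \<in> leaves ?T" "passes_through G R l'" "l'' \<in> leaves ?T" "passes_through G R l''" for R l' l''
      by (rule passing_leaf_unique[OF T _ that(3,4,1,2)]) (rule disj)
    ultimately have "mechanism_rule G R = eta_LA G l" if "R \<in> Pi\<^sub>E N Q" for R
      using that l(1) unfolding mechanism_rule_def
      by (intro arg_cong[where f = "eta_LA G"] the_equality) blast+
    with P P' ne show False by simp
  qed
  then obtain k where k: "k < length p" "\<exists>R\<in>Pi\<^sub>E N Q. \<not> ?follows R (p ! k)"
    and min: "\<And>k'. k' < k \<Longrightarrow> \<not> (k' < length p \<and> (\<exists>R\<in>Pi\<^sub>E N Q. \<not> ?follows R (p ! k')))"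
    using exists_least_iff[of "\<lambda>k. k < length p \<and> (\<exists>R\<in>Pi\<^sub>E N Q. \<not> ?follows R (p ! k))"] by blast
  obtain R0 where R0: "R0 \<in> Pi\<^sub>E N Q" "\<not> ?follows R0 (p ! k)"
    using k(2) by blast
  define e where "e = p ! k"
  define v where "v = tail ?T e"
  define i where "i = eta_NA G v"
  have e: "e \<in> out_arcs ?T v" "P i \<in> eta_EP G e" "R0 i \<notin> eta_EP G e"
    using p R0(2) nth_mem[OF k(1)] by (auto simp: e_def v_def i_def pre_digraph.awalk_def)
  have v: "v \<in> verts ?T - leaves ?T"
    using e(1) wf_digraph.tail_in_verts[OF T] by (auto simp: leaves_def)
  then have i: "i \<in> N"
    using bspec[OF mover] by (simp add: i_def)
  have "?walk (mroot G) (take k p @ e # drop (Suc k) p) l"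
    using p(1) id_take_nth_drop[OF k(1)] by (simp add: e_def)
  then have walk: "?walk (mroot G) (take k p) v"
    by (auto simp: wf_digraph.awalk_append_iff[OF T] wf_digraph.awalk_Cons_iff[OF T] v_def)
  have follows: "?follows R (p ! k')" if "R \<in> Pi\<^sub>E N Q" "k' < k" for R k'
    using min[OF that(2)] that k(1) by force
  have passes: "passes_through G R v" if "R \<in> Pi\<^sub>E N Q" for R
    unfolding passes_through_def
    using walk follows[OF that] k(1) by (intro exI[of _ "take k p"]) (auto simp: in_set_conv_nth)
  have union: "(\<forall>k'. last_move G i (take k p) k' \<longrightarrow>
        (\<Union>e\<in>out_arcs ?T v. eta_EP G e) = eta_EP G (take k p ! k')) \<and>
      ((\<nexists>k'. last_move G i (take k p) k') \<longrightarrow> (\<Union>e\<in>out_arcs ?T v. eta_EP G e) = Dom i)"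
    using bspec[OF cover v, THEN spec, THEN mp, OF walk] unfolding i_def .
  \<comment> \<open>\<open>R0\<close> leaves \<open>e\<close>, but some other arc out of
    \<open>v\<close> must take it: the labels there cover either the label of the previous arc of
    \<open>i\<close>, which \<open>R0\<close> followed since it comes before \<open>k\<close>, or
    all of \<open>Dom i\<close>.\<close>
  have "R0 i \<in> (\<Union>e\<in>out_arcs ?T v. eta_EP G e)"
  proof (cases "\<exists>k'. last_move G i (take k p) k'")
    case True
    then obtain k' where k': "last_move G i (take k p) k'" by blast
    then have "k' < k" "eta_NA G (tail ?T (p ! k')) = i"
      by (auto simp: last_move_def)
    then show ?thesis
      using union k' follows[OF R0(1), of k'] by (auto simp del: UN_iff)
  next
    case False
    then show ?thesis
      using union QD[OF R0(1)] i by (auto simp del: UN_iff)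
  qed
  then obtain e' where e': "e' \<in> out_arcs ?T v" "R0 i \<in> eta_EP G e'"
    by blast
  have "e \<noteq> e'" "e' \<noteq> e"
    using e(3) e'(2) by auto
  then have div: "diverge G i v (P i) (R0 i)" "diverge G i v (R0 i) (P i)"
    using e e' unfolding diverge_def i_def[symmetric] by blast+
  note osp_v = osp[unfolded OSP_def, rule_format, OF i v i_def[symmetric] QD QD]
  have "weak_part (P i) (mechanism_rule G R i) (mechanism_rule G R' i) \<and>
      weak_part (R0 i) (mechanism_rule G R' i) (mechanism_rule G R i)"
    if "R \<in> Pi\<^sub>E N Q" "R' \<in> Pi\<^sub>E N Q" "R i = P i \<and> R' i = R0 i" for R R'
    using osp_v[OF that(1,2)] osp_v[OF that(2,1)] passes[OF that(1)] passes[OF that(2)] div that(3)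
    by simp
  moreover have "P i \<noteq> R0 i" "P i \<in> Q i" "R0 i \<in> Q i"
    using e(2,3) PiE_mem[OF P i] PiE_mem[OF R0(1) i] by auto
  ultimately show ?thesis
    by (intro bexI[OF _ i] bexI[of _ "P i"] bexI[of _ "R0 i"] conjI ballI impI) blast+
qed

section \<open>A stable rule with a weak cycle\<close>

locale normalized_weak_cycle =
  fixes N :: "'i set" and A :: "'a set" and a0 :: 'a and prio :: "'a \<Rightarrow> ('i \<times> 'i) set"
    and i1 i2 i3 :: 'i and a1 a2 a3 :: 'a
  assumes prio: "priority_structure N A prio" and a0: "a0 \<notin> A"
    and cycle: "weak_cycle N A prio (i1, i2, i3) (a1, a2, a3)"
    and second: "(i2, i3) \<in> prio a1" "(i3, i1) \<in> prio a2"
begin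

lemma agents: "i1 \<in> N" "i2 \<in> N" "i3 \<in> N" "i1 \<noteq> i2" "i1 \<noteq> i3" "i2 \<noteq> i3"
  and objects: "a1 \<in> A" "a2 \<in> A" "a3 \<in> A" "a1 \<noteq> a2" "a1 \<noteq> a3" "a2 \<noteq> a3"
  using cycle unfolding weak_cycle_iff by blast+

text \<open>Collects which of the three agents can outrank a given one, to eliminate candidates for
  the holder \<open>j\<close> in stability claims. How \<open>a3\<close> ranks \<open>i1\<close> and
  \<open>i2\<close> is left open.\<close>

lemma above:
  assumes "j \<in> {i1, i2, i3}"
  shows "(j, i1) \<notin> prio a1" and "(j, i2) \<in> prio a1 \<Longrightarrow> j = i1"
    and "(j, i2) \<notin> prio a2" and "(j, i3) \<in> prio a2 \<Longrightarrow> j = i2"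
    and "(j, i3) \<notin> prio a3"
proof -
  have lo: "prio a1 \<in> linear_orders N" "prio a2 \<in> linear_orders N" "prio a3 \<in> linear_orders N"
    using prio objects unfolding priority_structure_def by blast+
  have first: "(i1, i2) \<in> prio a1" "(i1, i3) \<in> prio a1" "(i2, i1) \<in> prio a2" "(i2, i3) \<in> prio a2"
      "(i3, i1) \<in> prio a3" "(i3, i2) \<in> prio a3"
    using cycle unfolding weak_cycle_iff by blast+
  note irrefl = lo[THEN linear_orders_irrefl]
  show "(j, i1) \<notin> prio a1" "(j, i2) \<in> prio a1 \<Longrightarrow> j = i1"
    using assms irrefl first(1,2) second(1) linear_orders_asym[OF lo(1)] by blast+
  show "(j, i2) \<notin> prio a2" "(j, i3) \<in> prio a2 \<Longrightarrow> j = i2"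
    using assms irrefl first(3,4) second(2) linear_orders_asym[OF lo(2)] by blast+
  show "(j, i3) \<notin> prio a3"
    using assms irrefl first(5,6) linear_orders_asym[OF lo(3)] by blast
qed

section \<open>Profiles given by lists of acceptable objects\<close>

definition choice :: "'a list \<Rightarrow> 'a list \<Rightarrow> 'a list \<Rightarrow> 'i \<Rightarrow> 'a list" where
  "choice xs ys zs i = (if i = i1 then xs else if i = i2 then ys else if i = i3 then zs else [])"

text \<open>Through the empty list in \<open>choice\<close>, \<open>a0\<close> is the favorite of
  everyone outside the cycle, so only the priorities among \<open>i1\<close>, \<open>i2\<close>,
  \<open>i3\<close> matter.\<close>

definition restricted :: "('i \<Rightarrow> ('a \<times> 'a) set) \<Rightarrow> 'a list \<Rightarrow> 'a list \<Rightarrow> 'a list \<Rightarrow> bool" where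
  "restricted P xs ys zs \<longleftrightarrow> (\<forall>i\<in>N. P i \<in> linear_orders (insert a0 A) \<and>
     starts_with (P i) (choice xs ys zs i @ [a0]))"

text \<open>Any other agent has no acceptable object and is assigned \<open>a0\<close>, so the
  holder of a claimed object is among the three.\<close>

lemma stable_restricted:
  assumes "stable_matching N A a0 prio P \<mu>" and "restricted P xs ys zs"
    and ws: "(i, ws) \<in> {(i1, xs), (i2, ys), (i3, zs)}" "set ws \<subseteq> A"
  shows stable_restricted_range: "\<mu> i \<in> insert a0 (set ws)"
    and stable_restricted_claim: "k < length ws \<Longrightarrow>
      \<mu> i \<in> set (take (Suc k) ws) \<or> (\<exists>j\<in>{i1, i2, i3}. \<mu> j = ws ! k \<and> (j, i) \<in> prio (ws ! k))"
proof -
  have P: "P i \<in> linear_orders (insert a0 A)"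
    and start_choice: "starts_with (P i) (choice xs ys zs i @ [a0])" if "i \<in> N" for i
    using assms(2) that unfolding restricted_def by blast+
  have i: "i \<in> N" and "choice xs ys zs i = ws"
    using ws(1) agents by (auto simp: choice_def)
  then have start: "starts_with (P i) (ws @ [a0])"
    using start_choice by metis
  note st = stable_starts_with[OF assms(1) i P[OF i] start ws(2) a0]
  show "\<mu> i \<in> insert a0 (set ws)"
    by (rule st(1))
  show "\<mu> i \<in> set (take (Suc k) ws) \<or> (\<exists>j\<in>{i1, i2, i3}. \<mu> j = ws ! k \<and> (j, i) \<in> prio (ws ! k))"
    if k: "k < length ws"
  proof (cases "\<mu> i \<in> set (take (Suc k) ws)")
    case False
    from st(2)[OF k this] obtain j where j: "j \<in> N" "\<mu> j = ws ! k" "(j, i) \<in> prio (ws ! k)"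
      by blast
    have "j \<in> {i1, i2, i3}"
    proof (rule ccontr)
      assume "j \<notin> {i1, i2, i3}"
      then have "starts_with (P j) ([] @ [a0])"
        using start_choice[OF j(1)] by (simp add: choice_def)
      from stable_starts_with(1)[OF assms(1) j(1) P[OF j(1)] this] have "\<mu> j = a0"
        using a0 by simp
      moreover have "ws ! k \<in> A"
        using ws(2) k by (metis nth_mem subsetD)
      ultimately show False
        using j(2) a0 by simp
    qed
    with j show ?thesis
      by blast
  qed blast
qed

lemma stable_restricted_pair:
  assumes "stable_matching N A a0 prio P \<mu>" and "restricted P xs ys zs"
    and "(i, [x, y]) \<in> {(i1, xs), (i2, ys), (i3, zs)}" and "x \<in> A" "y \<in> A"
  shows "\<mu> i = x \<or> \<mu> i = y \<or> \<mu> i = a0"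
    and "\<mu> i = x \<or> (\<exists>j\<in>{i1, i2, i3}. \<mu> j = x \<and> (j, i) \<in> prio x)"
    and "\<mu> i = x \<or> \<mu> i = y \<or> (\<exists>j\<in>{i1, i2, i3}. \<mu> j = y \<and> (j, i) \<in> prio y)"
proof -
  have A: "set [x, y] \<subseteq> A"
    using assms(4,5) by simp
  note range = stable_restricted_range[OF assms(1-3) A]
    and claim = stable_restricted_claim[OF assms(1-3) A]
  show "\<mu> i = x \<or> \<mu> i = y \<or> \<mu> i = a0"
    using range by simp blast
  show "\<mu> i = x \<or> (\<exists>j\<in>{i1, i2, i3}. \<mu> j = x \<and> (j, i) \<in> prio x)"
    using claim[of 0] by simp
  show "\<mu> i = x \<or> \<mu> i = y \<or> (\<exists>j\<in>{i1, i2, i3}. \<mu> j = y \<and> (j, i) \<in> prio y)"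
    using claim[of 1] by simp
qed

lemma stable_inj:
  assumes "stable_matching N A a0 prio P \<mu>" and "x \<in> A"
  shows "\<mu> i1 = x \<Longrightarrow> \<mu> i2 \<noteq> x" and "\<mu> i1 = x \<Longrightarrow> \<mu> i3 \<noteq> x" and "\<mu> i2 = x \<Longrightarrow> \<mu> i3 \<noteq> x"
  using assms agents unfolding stable_matching_def by metis+

lemma object_neq: "a1 \<noteq> a0" "a2 \<noteq> a0" "a3 \<noteq> a0"
  using objects a0 by blast+

section \<open>Consequences of stability for each single report\<close>

lemma agent1_prefers_a3:
  assumes "stable_matching N A a0 prio P \<mu>" and "restricted P [a3, a1] ys zs"
  shows "\<mu> i1 = a3 \<or> \<mu> i1 = a1"
  using stable_restricted_pair(3)[OF assms, of i1 a3 a1] objects above(1) by blast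

lemma agent1_prefers_a2:
  assumes "stable_matching N A a0 prio P \<mu>" and "restricted P [a2, a3] ys zs"
  shows "\<mu> i1 \<noteq> a1" and "\<mu> i1 = a2 \<or> \<mu> i2 = a2 \<or> \<mu> i3 = a2"
    and "\<mu> i1 = a2 \<or> \<mu> i1 = a3 \<or> \<mu> i2 = a3 \<or> \<mu> i3 = a3"
  using stable_restricted_pair[OF assms, of i1 a2 a3] objects object_neq by (metis insertE insertI1 singletonD)+

lemma agent2_prefers_a1:
  assumes "stable_matching N A a0 prio P \<mu>" and "restricted P xs [a1, a3] zs"
  shows "\<mu> i2 \<noteq> a2" and "\<mu> i2 = a1 \<or> \<mu> i1 = a1"
  using stable_restricted_pair[OF assms, of i2 a1 a3] objects object_neq above(2) by (metis insertI1 insertI2)+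

lemma agent2_only_a3:
  assumes "stable_matching N A a0 prio P \<mu>" and "restricted P xs [a3] zs"
  shows "\<mu> i2 \<noteq> a1" and "\<mu> i2 \<noteq> a2" and "\<mu> i2 = a3 \<or> \<mu> i1 = a3 \<or> \<mu> i3 = a3"
proof -
  have "\<mu> i2 = a3 \<or> \<mu> i2 = a0"
    using stable_restricted_range[OF assms, of i2 "[a3]"] objects by auto
  then show "\<mu> i2 \<noteq> a1" "\<mu> i2 \<noteq> a2"
    using objects object_neq by metis+
  show "\<mu> i2 = a3 \<or> \<mu> i1 = a3 \<or> \<mu> i3 = a3"
    using stable_restricted_claim[OF assms, of i2 "[a3]" 0] objects by auto
qed

lemma agent3_prefers_a1_a3:
  assumes "stable_matching N A a0 prio P \<mu>" and "restricted P xs ys [a1, a3]"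
  shows "\<mu> i3 = a1 \<or> \<mu> i3 = a3" and "\<mu> i3 = a1 \<or> \<mu> i1 = a1 \<or> \<mu> i2 = a1"
  using stable_restricted_pair(2,3)[OF assms, of i3 a1 a3] objects above(5) by blast+

lemma agent3_prefers_a1_a2:
  assumes "stable_matching N A a0 prio P \<mu>" and "restricted P xs ys [a1, a2]"
  shows "\<mu> i3 \<noteq> a3" and "\<mu> i3 = a1 \<or> \<mu> i1 = a1 \<or> \<mu> i2 = a1" and "\<mu> i3 = a1 \<or> \<mu> i3 = a2 \<or> \<mu> i2 = a2"
proof -
  note pair = stable_restricted_pair[OF assms, of i3 a1 a2]
  show "\<mu> i3 \<noteq> a3"
    using pair(1) objects object_neq by (metis insertI1 insertI2)
  show "\<mu> i3 = a1 \<or> \<mu> i1 = a1 \<or> \<mu> i2 = a1"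
    using pair(2) objects by blast
  show "\<mu> i3 = a1 \<or> \<mu> i3 = a2 \<or> \<mu> i2 = a2"
    using pair(3) objects above(4) by blast
qed

text \<open>
  The digits in the names below are the indices of the acceptable objects of \<open>i1\<close>, \<open>i2\<close>, \<open>i3\<close>, in
  order of preference.
\<close>

lemma outcome_31_13_13:
  assumes st: "stable_matching N A a0 prio P \<mu>" and P: "restricted P [a3, a1] [a1, a3] [a1, a3]"
  shows "\<mu> i1 = a1" and "\<mu> i2 \<noteq> a1" and "\<mu> i2 \<noteq> a3"
proof -
  note inj1 = stable_inj[OF st objects(1)] and inj3 = stable_inj[OF st objects(3)]
  note 3 = agent3_prefers_a1_a3(1)[OF st P]
  \<comment> \<open>If \<open>i1\<close> had \<open>a3\<close>, then \<open>i2\<close> would have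
    \<open>a1\<close>, and \<open>i3\<close> neither, although no rival outranks \<open>i3\<close>
    at \<open>a3\<close>.\<close>
  show 1: "\<mu> i1 = a1"
    using agent1_prefers_a3[OF st P] agent2_prefers_a1(2)[OF st P] 3 inj1 inj3 by metis
  show "\<mu> i2 \<noteq> a1"
    using 1 inj1 by metis
  show "\<mu> i2 \<noteq> a3"
    using 1 3 inj1 inj3 by metis
qed

text \<open>Since \<open>i1\<close> does not want \<open>a1\<close>, it goes to \<open>i2\<close>.
  Only \<open>i2\<close> could outrank \<open>i3\<close> at \<open>a2\<close>, so \<open>i3\<close>
  gets \<open>a2\<close>, and \<open>a3\<close> remains for \<open>i1\<close>.\<close>

lemma outcome_23_13_12:
  assumes st: "stable_matching N A a0 prio P \<mu>" and P: "restricted P [a2, a3] [a1, a3] [a1, a2]"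
  shows "\<mu> i1 = a3"
proof -
  have 2: "\<mu> i2 = a1"
    using agent2_prefers_a1(2)[OF st P] agent1_prefers_a2(1)[OF st P] by metis
  then have 3: "\<mu> i3 = a2"
    using agent3_prefers_a1_a2(3)[OF st P] stable_inj(3)[OF st objects(1)] objects(4) by metis
  then show ?thesis
    using 2 agent1_prefers_a2(3)[OF st P] stable_inj(2)[OF st objects(2)] objects(5,6) by metis
qed

text \<open>The three favorites are distinct, so everyone gets hers.\<close>

lemma outcome_23_3_12:
  assumes st: "stable_matching N A a0 prio P \<mu>" and P: "restricted P [a2, a3] [a3] [a1, a2]"
  shows "\<mu> i2 = a3"
proof -
  note 2 = agent2_only_a3[OF st P]
  have 3: "\<mu> i3 = a1"
    using agent3_prefers_a1_a2(2)[OF st P] agent1_prefers_a2(1)[OF st P] 2(1) by metis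
  then have "\<mu> i1 = a2"
    using agent1_prefers_a2(2)[OF st P] 2(2) objects(4) by metis
  then show ?thesis
    using 2(3) 3 objects(5,6) by metis
qed

text \<open>Only \<open>i1\<close> can outrank \<open>i2\<close> at \<open>a1\<close>, so one of
  these two holds it.\<close>

lemma outcome_31_13_12:
  assumes st: "stable_matching N A a0 prio P \<mu>" and P: "restricted P [a3, a1] [a1, a3] [a1, a2]"
  shows "\<mu> i3 \<noteq> a1"
  using agent2_prefers_a1(2)[OF st P] stable_inj(2,3)[OF st objects(1)] by metis

lemma outcome_23_3_13:
  assumes st: "stable_matching N A a0 prio P \<mu>" and P: "restricted P [a2, a3] [a3] [a1, a3]"
  shows "\<mu> i3 = a1"
  using agent3_prefers_a1_a3(2)[OF st P] agent1_prefers_a2(1)[OF st P] agent2_only_a3(1)[OF st P]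
  by metis

text \<open>The rule is not constant on the eight profiles of the subdomain, so some agent's two
  reports are separated first. Whichever agent it is, one pair of profiles violates the resulting
  comparison.\<close>

lemma stable_rule_not_OSP:
  fixes f :: "('i \<Rightarrow> ('a \<times> 'a) set) \<Rightarrow> 'i \<Rightarrow> 'a"
  assumes fin: "finite A"
    and stable: "\<And>P. P \<in> N \<rightarrow>\<^sub>E linear_orders (insert a0 A) \<Longrightarrow> stable_matching N A a0 prio P (f P)"
  shows "\<not> OSP_implementable TYPE('v) TYPE('e) N A a0 (\<lambda>_. linear_orders (insert a0 A)) f"
proof
  let ?L = "linear_orders (insert a0 A)"
  assume "OSP_implementable TYPE('v) TYPE('e) N A a0 (\<lambda>_. ?L) f"
  then obtain G :: "('v, 'e, 'i, 'a) mechanism" where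
    G: "is_mechanism N A a0 (\<lambda>_. ?L) G" "OSP N (\<lambda>_. ?L) G"
    and f: "\<And>P. P \<in> N \<rightarrow>\<^sub>E ?L \<Longrightarrow> f P = mechanism_rule G P"
    unfolding OSP_implementable_def by blast
  have "\<exists>P\<in>?L. starts_with P (xs @ [a0])" if "distinct xs" "set xs \<subseteq> A" for xs
    using linear_order_starting_with[of "insert a0 A" "xs @ [a0]"] fin a0 that by auto
  then obtain pref where
    pref: "\<And>xs. distinct xs \<Longrightarrow> set xs \<subseteq> A \<Longrightarrow> pref xs \<in> ?L \<and> starts_with (pref xs) (xs @ [a0])"
    by metis
  have pref_hd: "(w, x) \<notin> pref (x # xs)"
    if "distinct (x # xs)" "set (x # xs) \<subseteq> A" for w x xs
    using starts_withD[of "pref (x # xs)" "(x # xs) @ [a0]" 0 w] pref[OF that] by simp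
  have pref_snd: "(w, y) \<in> pref [x, y] \<longleftrightarrow> w = x"
    if "distinct [x, y]" "set [x, y] \<subseteq> A" for w x y
    using starts_withD[of "pref [x, y]" "[x, y] @ [a0]" 1 w] pref[OF that] by simp
  define prof where "prof = (\<lambda>xs ys zs. \<lambda>i\<in>N. pref (choice xs ys zs i))"
  \<comment> \<open>Agents outside the cycle get a single report, so they can never be the ones to
    be separated.\<close>
  define W where "W = (\<lambda>i. if i = i1 then {[a3, a1], [a2, a3]} else if i = i2 then {[a1, a3], [a3]}
    else if i = i3 then {[a1, a3], [a1, a2]} else {[]})"
  define Q where "Q = (\<lambda>i. pref ` W i)"
  define ok where "ok = (\<lambda>xs ys zs. xs \<in> W i1 \<and> ys \<in> W i2 \<and> zs \<in> W i3)"
  have W: "distinct ws" "set ws \<subseteq> A" if "ws \<in> W i" for ws i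
    using that objects unfolding W_def by (auto split: if_splits)
  have choice_W: "choice xs ys zs i \<in> W i" if "ok xs ys zs" for xs ys zs i
    using that by (simp add: ok_def choice_def) (simp add: W_def)
  have prof_Q: "prof xs ys zs \<in> Pi\<^sub>E N Q" if "ok xs ys zs" for xs ys zs
    using choice_W[OF that] unfolding prof_def Q_def by simp
  have Q_L: "Q i \<subseteq> ?L" for i
    using pref W unfolding Q_def by blast
  define g where "g = (\<lambda>xs ys zs. f (prof xs ys zs))"
  have prof_L: "prof xs ys zs \<in> N \<rightarrow>\<^sub>E ?L" if "ok xs ys zs" for xs ys zs
    using prof_Q[OF that] Q_L by blast
  have st: "stable_matching N A a0 prio (prof xs ys zs) (g xs ys zs)"
    and mech: "g xs ys zs = mechanism_rule G (prof xs ys zs)" if "ok xs ys zs" for xs ys zs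
    unfolding g_def using stable f prof_L[OF that] by blast+
  have rs: "restricted (prof xs ys zs) xs ys zs" if "ok xs ys zs" for xs ys zs
    unfolding restricted_def using pref[OF W[OF choice_W[OF that]]] by (simp add: prof_def)
  have \<alpha>: "ok [a3, a1] [a1, a3] [a1, a3]" and \<beta>: "ok [a2, a3] [a1, a3] [a1, a2]"
    and \<gamma>: "ok [a2, a3] [a3] [a1, a2]" and \<delta>: "ok [a3, a1] [a1, a3] [a1, a2]"
    and \<epsilon>: "ok [a2, a3] [a3] [a1, a3]"
    using agents(4-6) by (fastforce simp: ok_def W_def)+
  note out\<alpha> = outcome_31_13_13[OF st[OF \<alpha>] rs[OF \<alpha>]] and out\<beta> = outcome_23_13_12[OF st[OF \<beta>] rs[OF \<beta>]]
    and out\<gamma> = outcome_23_3_12[OF st[OF \<gamma>] rs[OF \<gamma>]] and out\<delta> = outcome_31_13_12[OF st[OF \<delta>] rs[OF \<delta>]]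
    and out\<epsilon> = outcome_23_3_13[OF st[OF \<epsilon>] rs[OF \<epsilon>]]
  have ne: "mechanism_rule G (prof [a3, a1] [a1, a3] [a1, a3]) \<noteq>
      mechanism_rule G (prof [a2, a3] [a1, a3] [a1, a2])"
    using out\<alpha>(1) out\<beta> objects(5) mech[OF \<alpha>] mech[OF \<beta>] by metis
  obtain j p p' where j: "j \<in> N" "p \<in> Q j" "p' \<in> Q j" "p \<noteq> p'"
    and osp: "\<forall>R\<in>Pi\<^sub>E N Q. \<forall>R'\<in>Pi\<^sub>E N Q. R j = p \<and> R' j = p' \<longrightarrow>
       weak_part p (mechanism_rule G R j) (mechanism_rule G R' j) \<and>
       weak_part p' (mechanism_rule G R' j) (mechanism_rule G R j)"
    using OSP_first_divergence[OF G Q_L prof_Q[OF \<alpha>] prof_Q[OF \<beta>] ne]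
    by (elim bexE conjE) (rule that)
  have osp_g: "weak_part (prof xs ys zs j) (g xs ys zs j) (g xs' ys' zs' j)"
    if ok: "ok xs ys zs" "ok xs' ys' zs'"
      and "prof xs ys zs j = p \<and> prof xs' ys' zs' j = p' \<or> prof xs ys zs j = p' \<and> prof xs' ys' zs' j = p"
    for xs ys zs xs' ys' zs'
    using that(3) bspec[OF bspec[OF osp prof_Q[OF ok(1)]] prof_Q[OF ok(2)]]
      bspec[OF bspec[OF osp prof_Q[OF ok(2)]] prof_Q[OF ok(1)]]
    unfolding mech[OF ok(1)] mech[OF ok(2)] by auto
  \<comment> \<open>The two profiles used here differ in the report of each of the three agents, so
    together they exhaust every \<open>W i\<close>; hence \<open>p\<close> and \<open>p'\<close> are
    these two reports in some order.\<close>
  have W_pair: "W i \<subseteq> {choice [a3, a1] [a1, a3] [a1, a3] i, choice [a2, a3] [a3] [a1, a2] i}" for i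
    by (simp add: W_def choice_def)
  have pp: "p = pref (choice [a3, a1] [a1, a3] [a1, a3] j) \<and> p' = pref (choice [a2, a3] [a3] [a1, a2] j) \<or>
      p' = pref (choice [a3, a1] [a1, a3] [a1, a3] j) \<and> p = pref (choice [a2, a3] [a3] [a1, a2] j)"
    using j(2-4) W_pair[of j] unfolding Q_def by blast
  consider "j = i1" | "j = i2" | "j = i3"
    using pp j(4) unfolding choice_def by presburger
  then show False
  proof cases
    case 1
    \<comment> \<open>Truthful \<open>i1\<close> may end with \<open>a1\<close>, while the report
      \<open>[a2, a3]\<close> may give her favorite \<open>a3\<close>.\<close>
    then have "weak_part (pref [a3, a1]) (g [a3, a1] [a1, a3] [a1, a3] i1) (g [a2, a3] [a1, a3] [a1, a2] i1)"
      using osp_g[OF \<alpha> \<beta>] pp agents by (auto simp: prof_def choice_def)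
    then show False
      using out\<alpha>(1) out\<beta> pref_hd[of a3 "[a1]"] objects by (auto simp: weak_part_def)
  next
    case 2
    \<comment> \<open>Truthful \<open>i2\<close> may get neither \<open>a1\<close> nor
      \<open>a3\<close>, while the report \<open>[a3]\<close> may secure \<open>a3\<close>; only
      \<open>a1\<close> is above \<open>a3\<close> for her.\<close>
    then have "weak_part (pref [a1, a3]) (g [a3, a1] [a1, a3] [a1, a3] i2) (g [a2, a3] [a3] [a1, a2] i2)"
      using osp_g[OF \<alpha> \<gamma>] pp agents by (auto simp: prof_def choice_def)
    then show False
      using out\<alpha>(2,3) out\<gamma> pref_snd[of a1 a3] objects by (auto simp: weak_part_def)
  next
    case 3
    \<comment> \<open>Truthful \<open>i3\<close> may miss her favorite \<open>a1\<close>, while the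
      report \<open>[a1, a3]\<close> may obtain it. Here the true list is the one ending in
      \<open>a2\<close>.\<close>
    then have "weak_part (pref [a1, a2]) (g [a3, a1] [a1, a3] [a1, a2] i3) (g [a2, a3] [a3] [a1, a3] i3)"
      using osp_g[OF \<delta> \<epsilon>] pp agents by (auto simp: prof_def choice_def)
    then show False
      using out\<delta> out\<epsilon> pref_hd[of a1 "[a2]"] objects by (auto simp: weak_part_def)
  qed
qed

end

theorem proposition4p2:
  fixes n :: nat and N :: "nat set"
    and A :: "'a set" and a0 :: 'a
    and prio :: "'a \<Rightarrow> (nat \<times> nat) set"
  assumes "N = {1..n}"
    and "finite A" and "A \<noteq> {}" and "a0 \<notin> A"
    and "priority_structure N A prio"
    and "OSP_implementable TYPE('v) TYPE('e) N A a0 (\<lambda>_. linear_orders (insert a0 A))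
           (apda N A a0 prio)"
  shows "strongly_acyclic N A prio"
proof (rule ccontr)
  assume "\<not> strongly_acyclic N A prio"
  then obtain i1 i2 i3 a1 a2 a3 where "weak_cycle N A prio (i1, i2, i3) (a1, a2, a3)"
    "(i2, i3) \<in> prio a1" "(i3, i1) \<in> prio a2"
    using weak_cycle_normalize[OF assms(5)] unfolding strongly_acyclic_def by (metis surj_pair)
  then have "normalized_weak_cycle N A a0 prio i1 i2 i3 a1 a2 a3"
    using assms(4,5) by unfold_locales
  moreover have stable: "stable_matching N A a0 prio P (apda N A a0 prio P)"
    if "P \<in> N \<rightarrow>\<^sub>E linear_orders (insert a0 A)" for P
    using that assms(1,2,4,5) by (intro apda_stable) auto
  ultimately have "\<not> OSP_implementable TYPE('v) TYPE('e) N A a0 (\<lambda>_. linear_orders (insert a0 A))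
      (apda N A a0 prio)"
    using assms(2) by (intro normalized_weak_cycle.stable_rule_not_OSP)
  with assms(6) show False by contradiction
qed

end
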